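(* Let $\mathcal{G}:\mathcal{P}\times\mathcal{T}\to\mathbb{R}^{N_h}$, $(\boldsymbol{\mu},t)\mapsto\mathbf{u}(\boldsymbol{\mu},t)$, be a parameter-to-solution map satisfying the sampling criterion and the parameter-to-solution-map assumption described in the context. Consider a POD+DNN approximation $\mathcal{G}(\boldsymbol{\mu},t)\approx\mathbf{V}\hat{\mathbf{q}}(\boldsymbol{\mu},t)$, where $\hat{\mathbf{q}}:\mathbb{R}^{p+1}\to\mathbb{R}^N$ is a neural network trained over the training set of $N_{data}=N_sN_t$ input parameters and the corresponding snapshot matrix $\mathbf{U}\in\mathbb{R}^{N_h\times N_{data}}$, and $\mathbf{V}\in\mathbb{R}^{N_h\times N}$ is the POD projection matrix. Then $$\mathcal{E}_R\ge\frac{m}{M}\,\mathcal{E}_{POD,\infty}.$$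
   Context: Notation: $\|\cdot\|$ is the Euclidean norm, and $1\le N\le N_h$ is a fixed integer (POD dimension), with $N_h\in\mathbb{N}$ fixed. Sampling criterion: $p>0$, $\mathcal{P}\subset\mathbb{R}^p$ is compact (with positive measure, so that the uniform law $\mathcal{U}(\mathcal{P})$ is defined), $\mathcal{T}=[0,T]$ with $T>0$. Parameters $\boldsymbol{\mu}_1,\dots,\boldsymbol{\mu}_{N_s}$ are drawn i.i.d. from $\mathcal{U}(\mathcal{P})$; times are taken on the uniform grid $t_k=k\Delta t$, $k=1,\dots,N_t$, with $N_t\ge 2$, $\Delta t=T/N_t$. The training set consists of all $N_{data}=N_sN_t$ pairs $(\boldsymbol{\mu}_j,t_k)$. Parameter-to-solution-map assumption: $m=\operatorname{ess\,inf}_{\mathcal{P}\times\mathcal{T}}\|\mathbf{u}(\boldsymbol{\mu},t)\|>0$, $M=\operatorname{ess\,sup}_{\mathcal{P}\times\mathcal{T}}\|\mathbf{u}(\boldsymbol{\mu},t)\|<\infty$, and $\mathcal{G}$ is Lipschitz-continuous with constant $L>0$. POD: $\mathbf{U}\in\mathbb{R}^{N_h\times N_{data}}$ is the matrix whose columns are the snapshots $\mathbf{u}(\boldsymbol{\mu}_j,t_k)$; $\mathbf{V}\in\mathbb{R}^{N_h\times N}$ has as columns the first $N$ left singular vectors of $\mathbf{U}$ (so $\mathbf{V}^T\mathbf{V}=\mathbf{I}$). The continuous correlation matrix is $\mathbf{K}_\infty=\int_{\mathcal{P}\times\mathcal{T}}\mathbf{u}(\boldsymbol{\mu},t)\mathbf{u}(\boldsymbol{\mu},t)^T\,d(\boldsymbol{\mu},t)\in\mathbb{R}^{N_h\times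 N_h}$, with eigenvalues $\sigma_{1,\infty}^2\ge\dots\ge\sigma_{N_h,\infty}^2\ge 0$. Errors: $$\mathcal{E}_R=\Big(\int_{\mathcal{P}\times\mathcal{T}}\frac{\|\mathbf{u}(\boldsymbol{\mu},t)-\mathbf{V}\hat{\mathbf{q}}(\boldsymbol{\mu},t)\|^2}{\|\mathbf{u}(\boldsymbol{\mu},t)\|^2}\,d(\boldsymbol{\mu},t)\Big)^{1/2},\qquad \mathcal{E}_{POD,\infty}=m^{-1}\sqrt{\sum_{k>N}\sigma_{k,\infty}^2}.$$ A neural network is a feedforward network, i.e. a finite composition of affine maps and componentwise continuous activation functions. *)

theory Defs
  imports "HOL-Probability.Probability"
begin

definition param_time :: "(real^'p) set \<Rightarrow> real \<Rightarrow> ((real^'p) \<times> real) measure" where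
  "param_time P T = restrict_space lborel (P \<times> {0..T})"

definition essinf :: "'a measure \<Rightarrow> ('a \<Rightarrow> ereal) \<Rightarrow> ereal" where
  "essinf M f = - esssup M (\<lambda>x. - f x)"

(* A finite index type carries no order, so "the k-th row", "the k-th singular value" etc.
   refer to an enumeration of the type by 1, ..., CARD.  Below, r and c enumerate the rows and
   columns of U, and (r, c) also decide which entries of the rectangular middle factor lie on
   its diagonal.  Both orthogonal factors are square (full decomposition), and only the values
   sg 1, ..., sg (min CARD('h) CARD('d)) enter. *)
definition svd ::
  "('h::finite \<Rightarrow> nat) \<Rightarrow> ('d::finite \<Rightarrow> nat) \<Rightarrow> real^'d^'h \<Rightarrow> real^'h^'h \<Rightarrow> (nat \<Rightarrow> real) \<Rightarrow> real^'d^'d \<Rightarrow> bool"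
where
  "svd r c U W sg Z \<longleftrightarrow>
     bij_betw r UNIV {1..CARD('h)} \<and> bij_betw c UNIV {1..CARD('d)} \<and>
     orthogonal_matrix W \<and> orthogonal_matrix Z \<and>
     antimono sg \<and> (\<forall>k. 0 \<le> sg k) \<and>
     U = W ** (\<chi> i j. if r i = c j then sg (r i) else 0) ** transpose Z"

(* The columns of V are left singular vectors number 1, ..., CARD('n) of U; e enumerates the
   columns of V.  Singular vectors are not unique, hence a relation. *)
definition pod_matrix :: "real^'d^'h \<Rightarrow> real^'n^'h \<Rightarrow> bool" where
  "pod_matrix U V \<longleftrightarrow>
     (\<exists>r c W sg Z (e :: 'n \<Rightarrow> nat). svd r c U W sg Z \<and> bij_betw e UNIV {1..CARD('n)} \<and>
        (\<forall>i j. e i = r j \<longrightarrow> column i V = column j W))"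

definition correlation_matrix ::
  "(real^'p) set \<Rightarrow> real \<Rightarrow> ((real^'p) \<times> real \<Rightarrow> real^'h) \<Rightarrow> real^'h^'h" where
  "correlation_matrix P T u = (\<chi> i j. \<integral>x. u x $ i * u x $ j \<partial>param_time P T)"

(* lam 1 \<ge> ... \<ge> lam CARD('h) are the roots of the characteristic polynomial, with multiplicity. *)
definition ordered_eigenvalues :: "real^'h^'h \<Rightarrow> (nat \<Rightarrow> real) \<Rightarrow> bool" where
  "ordered_eigenvalues K lam \<longleftrightarrow>
     (\<forall>x. det (mat x - K) = (\<Prod>k=1..CARD('h). x - lam k)) \<and>
     (\<forall>i j. 1 \<le> i \<and> i \<le> j \<and> j \<le> CARD('h) \<longrightarrow> lam j \<le> lam i)"

(* In "hidden_layer n f", f maps a network input to the values of the first n neurons of some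
   layer; f x i is irrelevant for i \<ge> n.  Neurons are indexed by nat because the widths vary
   from layer to layer, which type-indexed vectors cannot express. *)
inductive hidden_layer :: "nat \<Rightarrow> ('a::euclidean_space \<Rightarrow> nat \<Rightarrow> real) \<Rightarrow> bool" where
  input: "hidden_layer n (\<lambda>x i. w i \<bullet> x + b i)"
| affine: "hidden_layer n f \<Longrightarrow> hidden_layer k (\<lambda>x i. (\<Sum>j<n. A i j * f x j) + b i)"
| activation: "hidden_layer n f \<Longrightarrow> (\<And>i. continuous_on UNIV (\<rho> i)) \<Longrightarrow>
    hidden_layer n (\<lambda>x i. \<rho> i (f x i))" for \<rho> :: "nat \<Rightarrow> real \<Rightarrow> real"

(* The last map is affine with matrix columns a j.  Networks that begin or end with an activation
   are covered by taking the first or last affine map to be the identity. *)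
definition neural_network :: "('a::euclidean_space \<Rightarrow> 'b::euclidean_space) \<Rightarrow> bool" where
  "neural_network q \<longleftrightarrow>
     (\<exists>n f a b. hidden_layer n f \<and> q = (\<lambda>x. (\<Sum>j<n. f x j *\<^sub>R a j) + b))"

definition relative_error ::
  "(real^'p) set \<Rightarrow> real \<Rightarrow> ((real^'p) \<times> real \<Rightarrow> real^'h) \<Rightarrow> ((real^'p) \<times> real \<Rightarrow> real^'h) \<Rightarrow> real" where
  "relative_error P T u v =
     sqrt (\<integral>x. (norm (u x - v x))\<^sup>2 / (norm (u x))\<^sup>2 \<partial>param_time P T)"

definition pod_error :: "real \<Rightarrow> nat \<Rightarrow> nat \<Rightarrow> (nat \<Rightarrow> real) \<Rightarrow> real" where
  "pod_error m N Nh lam = inverse m * sqrt (\<Sum>k\<in>{N<..Nh}. lam k)"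

end

theory Submission
  imports Defs
begin

text \<open>
  Since \<open>\<parallel>u\<parallel> \<le> M\<close> almost everywhere, it suffices to bound \<open>\<integral>\<parallel>u - V q\<parallel>\<^sup>2\<close> from below.
  The matrix \<open>V\<close> has orthonormal columns, so whatever the network \<open>q\<close> is,
  \<open>\<parallel>u - V q\<parallel>\<^sup>2 \<ge> \<parallel>u\<parallel>\<^sup>2 - \<parallel>V\<^sup>T u\<parallel>\<^sup>2\<close>, and the right-hand side integrates to
  \<open>tr K - tr (V\<^sup>T K V)\<close> with \<open>K\<close> the correlation matrix. In an orthonormal eigenbasis of \<open>K\<close>
  with eigenvalues \<open>d\<^sub>j\<close> this is \<open>\<Sum>\<^sub>j d\<^sub>j (1 - w\<^sub>j)\<close> with weights \<open>0 \<le> w\<^sub>j \<le> 1\<close> that add up to \<open>N\<close>,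
  which is least when the weights select the \<open>N\<close> largest eigenvalues. The comparison with the
  \<open>N\<close>-th eigenvalue as a threshold only involves sums over all eigenvalues, so equality of the
  characteristic polynomials replaces sorting the \<open>d\<^sub>j\<close>.
\<close>

section \<open>Spectral theorem for symmetric matrices\<close>

text \<open>A maximiser of \<open>x \<bullet> f x\<close> over the unit sphere of \<open>S\<close>
  is an eigenvector, by a first-variation argument. Allowing an invariant subspace \<open>S\<close>
  prepares the induction on dimension.\<close>

lemma symmetric_linear_eigenvector:
  fixes f :: "'a::euclidean_space \<Rightarrow> 'a"
  assumes f: "linear f" and sym: "\<And>x y. f x \<bullet> y = x \<bullet> f y"
    and S: "subspace S" "S \<noteq> {0}" "f ` S \<subseteq> S"
  obtains x c where "x \<in> S" "norm x = 1" "f x = c *\<^sub>R x"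
proof -
  let ?A = "S \<inter> sphere 0 1"
  obtain y where y: "y \<in> S" "y \<noteq> 0" using S(1,2) subspace_0 by blast
  have "y /\<^sub>R norm y \<in> ?A" using y S(1) by (simp add: subspace_scale)
  moreover have "compact ?A"
    using closed_subspace[OF S(1)] by (auto intro: closed_Int_compact)
  moreover have "continuous_on ?A (\<lambda>x. x \<bullet> f x)"
    using f by (intro continuous_on_inner continuous_on_id linear_continuous_on)
      (simp add: linear_conv_bounded_linear)
  ultimately obtain x where x: "x \<in> ?A" and max: "\<And>z. z \<in> ?A \<Longrightarrow> z \<bullet> f z \<le> x \<bullet> f x"
    using continuous_attains_sup[of ?A "\<lambda>x. x \<bullet> f x"] by blast
  define c where "c = x \<bullet> f x"
  have x1: "x \<bullet> x = 1" using x by (simp add: norm_eq_1)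
  have pos: "z \<bullet> f z \<le> c * (z \<bullet> z)" if "z \<in> S" for z
  proof (cases "z = 0")
    case False
    let ?z = "z /\<^sub>R norm z"
    have "?z \<in> ?A" using that False S(1) by (simp add: subspace_scale)
    from max[OF this] have "(z \<bullet> f z) / (norm z)\<^sup>2 \<le> c"
      by (simp add: c_def linear_scale[OF f] power2_eq_square divide_inverse mult_ac)
    then show ?thesis using False by (simp add: divide_le_eq power2_norm_eq_inner)
  qed (simp add: linear_0[OF f])
  \<comment> \<open>The quadratic form \<open>c * (z \<bullet> z) - z \<bullet> f z\<close> is nonnegative on \<open>S\<close> and vanishes at \<open>x\<close>;
    moving from \<open>x\<close> in the direction of the residual \<open>y\<close> shows \<open>y = 0\<close>.\<close>
  define y where "y = f x - c *\<^sub>R x"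
  have yS: "y \<in> S"
    unfolding y_def using x S(1,3) by (intro subspace_diff subspace_scale) auto
  have quad: "0 \<le> - 2 * t * (y \<bullet> y) + t\<^sup>2 * (c * (y \<bullet> y) - y \<bullet> f y)" for t
  proof -
    have "x + t *\<^sub>R y \<in> S" using x yS S(1) by (simp add: subspace_add subspace_scale)
    from pos[OF this]
    have "x \<bullet> f x + 2 * t * (y \<bullet> f x) + t\<^sup>2 * (y \<bullet> f y)
      \<le> c * (x \<bullet> x) + 2 * t * (c * (y \<bullet> x)) + t\<^sup>2 * (c * (y \<bullet> y))"
      using sym[of x y]
      by (simp add: linear_add[OF f] linear_scale[OF f] inner_add_left inner_add_right
          power2_eq_square algebra_simps inner_commute)
    moreover have "y \<bullet> y = y \<bullet> f x - c * (y \<bullet> x)"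
      by (subst (2) y_def) (simp add: inner_diff_right)
    then have "2 * t * (y \<bullet> y) = 2 * t * (y \<bullet> f x) - 2 * t * (c * (y \<bullet> x))"
      by (simp add: right_diff_distrib)
    ultimately show ?thesis using x1 unfolding c_def[symmetric] by (simp add: right_diff_distrib)
  qed
  have "y \<bullet> y \<le> 0"
  proof (rule ccontr)
    assume "\<not> y \<bullet> y \<le> 0"
    then have a: "y \<bullet> y > 0" by linarith
    let ?b = "c * (y \<bullet> y) - y \<bullet> f y"
    have b: "?b \<ge> 0" using pos[OF yS] by simp
    \<comment> \<open>This \<open>t\<close> makes the quadratic term at most half of the linear one;
      the \<open>+ 1\<close> keeps the denominator positive when \<open>?b = 0\<close>.\<close>
    define t where "t = (y \<bullet> y) / (?b + 1)"
    have t: "t > 0" "t * ?b \<le> y \<bullet> y"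
      using a b by (auto simp: t_def divide_le_eq mult_left_mono)
    have "t * (2 * (y \<bullet> y)) \<le> t * (t * ?b)"
      using quad[of t] by (simp add: power2_eq_square algebra_simps)
    then have "2 * (y \<bullet> y) \<le> t * ?b" using t(1) mult_le_cancel_left_pos by blast
    then show False using t(2) a by linarith
  qed
  then have "y = 0" using inner_gt_zero_iff[of y] by linarith
  then have "f x = c *\<^sub>R x" by (simp add: y_def)
  then show thesis using that x by auto
qed

text \<open>Split off one unit eigenvector \<open>x\<close> and apply the induction hypothesis to
  its orthogonal complement \<open>R\<close> in \<open>S\<close>, which \<open>f\<close> preserves
  because \<open>x \<bullet> f y = f x \<bullet> y = c * (x \<bullet> y)\<close>.\<close>

lemma symmetric_linear_eigenbasis:
  fixes f :: "'a::euclidean_space \<Rightarrow> 'a"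
  assumes f: "linear f" and sym: "\<And>x y. f x \<bullet> y = x \<bullet> f y"
    and "subspace S" "f ` S \<subseteq> S"
  shows "\<exists>B. pairwise orthogonal B \<and> (\<forall>x\<in>B. norm x = 1 \<and> (\<exists>c. f x = c *\<^sub>R x)) \<and> span B = S"
  using assms(3,4)
proof (induction "dim S" arbitrary: S rule: less_induct)
  case less
  show ?case
  proof (cases "S = {0}")
    case True
    then show ?thesis by (intro exI[of _ "{}"]) auto
  next
    case False
    obtain x c where x: "x \<in> S" "norm x = 1" "f x = c *\<^sub>R x"
      using symmetric_linear_eigenvector[OF f sym less.prems(1) False less.prems(2)] by blast
    have xx: "x \<bullet> x = 1" using x by (simp add: norm_eq_1)
    define R where "R = S \<inter> {y. x \<bullet> y = 0}"
    have R: "subspace R"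
      unfolding R_def using less.prems(1) by (intro subspace_inter subspace_hyperplane)
    have "x \<notin> R" using xx by (simp add: R_def)
    then have "R \<subset> S" using x(1) unfolding R_def by blast
    then have "dim R < dim S"
      using R less.prems(1) by (intro dim_psubset) (simp add: span_eq_iff[THEN iffD2])
    moreover have "f ` R \<subseteq> R"
      using less.prems(2) by (auto simp: R_def sym[of x, symmetric] x(3))
    ultimately obtain B where B: "pairwise orthogonal B"
        "\<forall>x\<in>B. norm x = 1 \<and> (\<exists>c. f x = c *\<^sub>R x)" "span B = R"
      using less.hyps R by blast
    have BR: "y \<in> R" if "y \<in> B" for y using B(3) that span_base by blast
    have "y \<in> span (insert x B)" if "y \<in> S" for y
    proof -
      have "y - (x \<bullet> y) *\<^sub>R x \<in> span B"
        using that x(1) xx less.prems(1)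
        by (simp add: B(3) R_def subspace_diff subspace_scale inner_diff_right)
      then show ?thesis by (subst span_insert) auto
    qed
    moreover have "span (insert x B) \<subseteq> S"
      using x(1) BR less.prems(1) by (intro span_minimal) (auto simp: R_def)
    ultimately have "span (insert x B) = S" by blast
    moreover have "pairwise orthogonal (insert x B)"
      using B(1) BR by (auto simp: pairwise_insert orthogonal_def R_def inner_commute)
    ultimately show ?thesis using B(2) x by (intro exI[of _ "insert x B"]) auto
  qed
qed

text \<open>An orthonormal eigenbasis has \<open>CARD('n)\<close> elements, so it can be indexed by
  \<open>'n\<close> itself and its members become the columns of \<open>Q\<close>.\<close>

lemma symmetric_matrix_eigenbasis:
  fixes K :: "real^'n^'n"
  assumes "transpose K = K"
  obtains Q d where "orthogonal_matrix Q" "\<And>j. K *v column j Q = d j *\<^sub>R column j Q"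
proof -
  have "(K *v x) \<bullet> y = x \<bullet> (K *v y)" for x y
    by (metis assms dot_lmul_matrix vector_transpose_matrix)
  from symmetric_linear_eigenbasis[of "(*v) K" UNIV, OF _ this]
  obtain B where B: "pairwise orthogonal B"
      "\<And>x. x \<in> B \<Longrightarrow> norm x = 1 \<and> (\<exists>c. K *v x = c *\<^sub>R x)" "span B = (UNIV::(real^'n) set)"
    by auto
  have ind: "independent B"
    using B(1,2) by (intro pairwise_orthogonal_independent) (use norm_zero in force)+
  have "card B = CARD('n)"
    using dim_span_eq_card_independent[OF ind] B(3) by simp
  moreover have "finite B" using ind independent_imp_finite by blast
  ultimately obtain b where b: "bij_betw b (UNIV::'n set) B"
    using finite_same_card_bij[of "UNIV::'n set" B] by auto
  define Q :: "real^'n^'n" where "Q = (\<chi> i j. b j $ i)"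
  have col: "column j Q = b j" for j by (simp add: Q_def column_def vec_eq_iff)
  have bB: "b j \<in> B" for j using b bij_betwE by blast
  have "orthogonal_matrix Q"
    unfolding orthogonal_matrix_orthonormal_columns col
    using B(1,2) bB b by (simp add: pairwise_def bij_betw_def inj_def) blast
  moreover obtain d where "\<And>j. K *v b j = d j *\<^sub>R b j" using B(2)[OF bB] by metis
  ultimately show thesis using that col by metis
qed

section \<open>Characteristic polynomials and sums over eigenvalues\<close>

text \<open>The columns of \<open>Q\<close> diagonalise \<open>mat x - K\<close>, and the nonzero
  factor \<open>det Q\<close> cancels.\<close>

lemma det_mat_minus_eigenbasis:
  fixes K :: "real^'n^'n"
  assumes Q: "orthogonal_matrix Q" and d: "\<And>j. K *v column j Q = d j *\<^sub>R column j Q"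
  shows "det (mat x - K) = (\<Prod>j\<in>UNIV. x - d j)"
proof -
  define D :: "real^'n^'n" where "D = (\<chi> i j. if i = j then x - d j else 0)"
  have "(mat x - K) ** Q = Q ** D"
  proof -
    have "((mat x - K) ** Q) $ i $ j = (Q ** D) $ i $ j" for i j
    proof -
      have "((mat x - K) ** Q) $ i $ j = ((mat x - K) *v column j Q) $ i"
        by (simp add: matrix_matrix_mult_def matrix_vector_mult_def column_def)
      also have "\<dots> = (x *\<^sub>R column j Q - K *v column j Q) $ i"
        by (simp add: matrix_vector_mult_diff_rdistrib)
          (simp add: matrix_vector_mult_def mat_def if_distrib if_distribR cong: if_cong)
      also have "\<dots> = (Q ** D) $ i $ j"
        unfolding d by (simp add: D_def matrix_matrix_mult_def column_def if_distrib algebra_simps cong: if_cong)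
      finally show ?thesis .
    qed
    then show ?thesis by (simp add: vec_eq_iff)
  qed
  then have "det (mat x - K) * det Q = det Q * det D" by (metis det_mul)
  moreover have "det Q \<noteq> 0" using det_orthogonal_matrix[OF Q] by auto
  moreover have "det D = (\<Prod>j\<in>UNIV. x - d j)"
    by (subst det_diagonal) (auto simp: D_def)
  ultimately show ?thesis by simp
qed

text \<open>Over a domain of characteristic 0, polynomials with equal values coincide, so both sides
  have the same multiset of roots. The index sets may differ, which lets eigenvalues indexed by a
  finite type be compared with an ordered sequence.\<close>

lemma prod_linear_factors_eq_imp_sum_eq:
  fixes a :: "'i \<Rightarrow> 'a::{idom,ring_char_0}" and b :: "'j \<Rightarrow> 'a"
  assumes "finite A" "finite B" "\<And>x. (\<Prod>i\<in>A. x - a i) = (\<Prod>j\<in>B. x - b j)"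
  shows "(\<Sum>i\<in>A. g (a i)) = (\<Sum>j\<in>B. g (b j))"
proof -
  have "poly (\<Prod>i\<in>A. [:- a i, 1:]) = poly (\<Prod>j\<in>B. [:- b j, 1:])"
    using assms(3) by (intro ext) (simp add: poly_prod)
  then have "proots (\<Prod>i\<in>A. [:- a i, 1:]) = proots (\<Prod>j\<in>B. [:- b j, 1:])"
    by (simp add: poly_eq_poly_eq_iff)
  then have "(\<Sum>i\<in>A. {#a i#}) = (\<Sum>j\<in>B. {#b j#})"
    by (simp add: proots_prod)
  then have "image_mset a (mset_set A) = image_mset b (mset_set B)"
    by (simp add: sum_unfold_sum_mset)
  then have "image_mset g (image_mset a (mset_set A)) = image_mset g (image_mset b (mset_set B))"
    by simp
  then show ?thesis by (simp add: sum_unfold_sum_mset multiset.map_comp o_def)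
qed

section \<open>Isometries and Ky Fan's inequality\<close>

text \<open>Pythagoras: \<open>V *v (transpose V *v x)\<close> is the orthogonal projection of
  \<open>x\<close> onto the range of \<open>V\<close>, and the last term measures how far the
  coordinates \<open>y\<close> are from the optimal ones.\<close>

lemma norm_diff_isometry_image:
  fixes V :: "real^'n^'h"
  assumes "transpose V ** V = mat 1"
  shows "(norm (x - V *v y))\<^sup>2 = (norm x)\<^sup>2 - (norm (transpose V *v x))\<^sup>2 + (norm (transpose V *v x - y))\<^sup>2"
proof -
  have 1: "(V *v z) \<bullet> w = z \<bullet> (transpose V *v w)" for z w
    by (metis dot_lmul_matrix vector_transpose_matrix transpose_transpose)
  have "(V *v y) \<bullet> (V *v y) = y \<bullet> y"
    by (simp add: 1 matrix_vector_mul_assoc assms)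
  then show ?thesis
    using 1[of y x]
    by (simp add: power2_norm_eq_inner inner_diff_left inner_diff_right inner_commute)
qed


text \<open>The choice \<open>y = transpose Q *v x\<close> in the Pythagorean identity reproduces
  \<open>x\<close> exactly, so its left-hand side vanishes.\<close>

lemma norm_transpose_orthogonal_matrix:
  fixes Q :: "real^'n^'n"
  assumes "orthogonal_matrix Q"
  shows "norm (transpose Q *v x) = norm x"
proof -
  have "Q *v (transpose Q *v x) = x" "transpose Q ** Q = mat 1"
    using assms
    by (simp_all add: matrix_vector_mul_assoc orthogonal_matrix_def del: transpose_matrix_vector)
  from norm_diff_isometry_image[OF this(2), of x "transpose Q *v x"] this(1)
  show ?thesis by simp
qed

text \<open>Bessel's inequality, from the analogous choice of \<open>y\<close>: the left-hand side
  is a square.\<close>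

lemma norm_transpose_isometry_le:
  fixes V :: "real^'n^'h"
  assumes "transpose V ** V = mat 1"
  shows "norm (transpose V *v x) \<le> norm x"
proof -
  have "0 \<le> (norm x)\<^sup>2 - (norm (transpose V *v x))\<^sup>2"
    using norm_diff_isometry_image[OF assms, of x "transpose V *v x"] by (metis add.right_neutral
      diff_self norm_zero power_zero_numeral zero_le_power2)
  then show ?thesis by (simp add: power2_le_iff_abs_le)
qed

lemma norm_transpose_mult_power2:
  fixes V :: "real^'n^'h"
  shows "(norm (transpose V *v x))\<^sup>2 = (\<Sum>k\<in>UNIV. (column k V \<bullet> x)\<^sup>2)"
  unfolding power2_norm_eq_inner
  by (simp add: inner_vec_def matrix_vector_mult_def column_def transpose_def power2_eq_square)

lemma quadratic_form_eigenbasis: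
  fixes K :: "real^'n^'n"
  assumes Q: "orthogonal_matrix Q" and d: "\<And>j. K *v column j Q = d j *\<^sub>R column j Q"
  shows "v \<bullet> (K *v v) = (\<Sum>j\<in>UNIV. d j * (column j Q \<bullet> v)\<^sup>2)"
proof -
  have "v = Q *v (transpose Q *v v)"
    using Q
    by (simp add: matrix_vector_mul_assoc orthogonal_matrix_def del: transpose_matrix_vector)
  also have "\<dots> = (\<Sum>j\<in>UNIV. (column j Q \<bullet> v) *\<^sub>R column j Q)"
    unfolding matrix_mult_sum
    by (simp add: scalar_mult_eq_scaleR matrix_vector_mul_component transpose_def column_def
        inner_vec_def mult.commute)
  finally have v: "v = (\<Sum>j\<in>UNIV. (column j Q \<bullet> v) *\<^sub>R column j Q)" .
  \<comment> \<open>Only the argument of \<open>K\<close> is expanded; pairing with the other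
    \<open>v\<close> supplies the second factor \<open>column j Q \<bullet> v\<close>.\<close>
  have "K *v v = (\<Sum>j\<in>UNIV. (column j Q \<bullet> v) *\<^sub>R (d j *\<^sub>R column j Q))"
    by (subst v) (simp add: linear_sum linear_scale d)
  then show ?thesis
    by (simp add: inner_sum_right power2_eq_square inner_commute mult_ac)
qed

text \<open>A form of Ky Fan's trace inequality.\<close>
lemma trace_minus_compression_ge:
  fixes K :: "real^'h^'h" and V :: "real^'n^'h"
  assumes K: "transpose K = K" and V: "transpose V ** V = mat 1"
    and lam: "ordered_eigenvalues K lam" and N: "CARD('n) \<le> CARD('h)"
  shows "(\<Sum>k\<in>{CARD('n)<..CARD('h)}. lam k)
    \<le> trace K - (\<Sum>k\<in>UNIV. column k V \<bullet> (K *v column k V))"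
proof -
  obtain Q d where Q: "orthogonal_matrix Q" and d: "\<And>j. K *v column j Q = d j *\<^sub>R column j Q"
    using symmetric_matrix_eigenbasis[OF K] by blast
  \<comment> \<open>Sums of any \<open>g\<close> over the spectrum do not depend on the enumeration;
    below, \<open>g\<close> is \<open>\<lambda>z. min (z - ?t) 0\<close>.\<close>
  have spec: "(\<Sum>j\<in>UNIV. g (d j)) = (\<Sum>k=1..CARD('h). g (lam k))" for g :: "real \<Rightarrow> real"
    using lam det_mat_minus_eigenbasis[OF Q d]
    by (intro prod_linear_factors_eq_imp_sum_eq) (auto simp: ordered_eigenvalues_def)
  have Q1: "norm (column j Q) = 1" for j
    using Q by (simp add: orthogonal_matrix_orthonormal_columns)
  have V1: "norm (column k V) = 1" for k
    using V by (simp add: matrix_mult_transpose_dot_column vec_eq_iff mat_def norm_eq_1)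
  \<comment> \<open>\<open>w j\<close> is the squared length of the projection of the
    \<open>j\<close>-th eigenvector onto the range of \<open>V\<close>.\<close>
  define w where "w j = (norm (transpose V *v column j Q))\<^sup>2" for j
  have w1: "w j \<le> 1" for j
    using norm_transpose_isometry_le[OF V, of "column j Q"] by (simp add: w_def Q1 power_le_one)
  \<comment> \<open>The squares of all \<open>column k V \<bullet> column j Q\<close> are summed in
    the other order; each column of \<open>V\<close> contributes 1.\<close>
  have "(\<Sum>j\<in>UNIV. w j) = (\<Sum>k\<in>UNIV. (norm (transpose Q *v column k V))\<^sup>2)"
    unfolding w_def norm_transpose_mult_power2 by (subst sum.swap) (simp add: inner_commute)
  then have sumw: "(\<Sum>j\<in>UNIV. w j) = CARD('n)"
    by (simp add: norm_transpose_orthogonal_matrix[OF Q] V1 del: transpose_matrix_vector)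
  have "K $ i $ i = (\<Sum>j\<in>UNIV. d j * (column j Q $ i)\<^sup>2)" for i
    using quadratic_form_eigenbasis[OF Q d, of "axis i 1"]
    by (simp add: inner_axis inner_axis' matrix_vector_mul_component)
  then have "trace K = (\<Sum>j\<in>UNIV. d j * (\<Sum>i\<in>UNIV. (column j Q $ i)\<^sup>2))"
    unfolding trace_def by (simp add: sum_distrib_left) (rule sum.swap)
  also have "\<dots> = (\<Sum>j\<in>UNIV. d j * (norm (column j Q))\<^sup>2)"
    unfolding power2_norm_eq_inner by (simp add: inner_vec_def power2_eq_square)
  finally have tr: "trace K = (\<Sum>j\<in>UNIV. d j)" by (simp add: Q1)
  have "(\<Sum>k\<in>UNIV. column k V \<bullet> (K *v column k V)) = (\<Sum>j\<in>UNIV. d j * w j)"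
    unfolding quadratic_form_eigenbasis[OF Q d] w_def norm_transpose_mult_power2 sum_distrib_left
    by (subst sum.swap) (simp add: inner_commute)
  then have eq: "trace K - (\<Sum>k\<in>UNIV. column k V \<bullet> (K *v column k V)) = (\<Sum>j\<in>UNIV. d j * (1 - w j))"
    by (simp add: tr right_diff_distrib sum_subtractf)
  \<comment> \<open>With this threshold, \<open>min (lam k - ?t) 0\<close> is
    \<open>lam k - ?t\<close> beyond index \<open>CARD('n)\<close> and 0 up to it. The tail thus
    becomes a sum over the whole spectrum, to which \<open>spec\<close> applies.\<close>
  let ?t = "lam CARD('n)"
  have split: "{1..CARD('h)} = {1..CARD('n)} \<union> {CARD('n)<..CARD('h)}" using N by auto
  have mono: "lam j \<le> lam i" if "1 \<le> i" "i \<le> j" "j \<le> CARD('h)" for i j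
    using lam that by (auto simp: ordered_eigenvalues_def)
  have "(\<Sum>k\<in>{CARD('n)<..CARD('h)}. lam k)
      = (\<Sum>k\<in>{CARD('n)<..CARD('h)}. min (lam k - ?t) 0) + ?t * (real CARD('h) - real CARD('n))"
  proof -
    have "(\<Sum>k\<in>{CARD('n)<..CARD('h)}. min (lam k - ?t) 0) = (\<Sum>k\<in>{CARD('n)<..CARD('h)}. lam k - ?t)"
      using mono[of "CARD('n)"] by (intro sum.cong) (auto simp: Suc_leI)
    then show ?thesis using N by (simp add: sum_subtractf of_nat_diff algebra_simps)
  qed
  also have "(\<Sum>k\<in>{CARD('n)<..CARD('h)}. min (lam k - ?t) 0) = (\<Sum>k=1..CARD('h). min (lam k - ?t) 0)"
  proof -
    have "(\<Sum>k=1..CARD('n). min (lam k - ?t) 0) = 0"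
      using mono[of _ "CARD('n)"] N by (intro sum.neutral) auto
    then show ?thesis unfolding split by (subst sum.union_disjoint) auto
  qed
  also have "\<dots> = (\<Sum>j\<in>UNIV. min (d j - ?t) 0)" by (rule spec[symmetric])
  \<comment> \<open>The factors \<open>1 - w j\<close> add up to \<open>CARD('h) - CARD('n)\<close>,
    so the multiple of \<open>?t\<close> can be distributed over the eigenvectors.\<close>
  also have "\<dots> + ?t * (real CARD('h) - real CARD('n)) = (\<Sum>j\<in>UNIV. min (d j - ?t) 0 + ?t * (1 - w j))"
    by (simp add: sum.distrib right_diff_distrib sum_subtractf flip: sum_distrib_left sumw)
  also have "\<dots> \<le> (\<Sum>j\<in>UNIV. d j * (1 - w j))"
  proof (intro sum_mono)
    fix j
    \<comment> \<open>For \<open>d j \<ge> ?t\<close> the right-hand side is a product of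
      nonnegative factors; otherwise a negative number is multiplied by a factor at most 1.\<close>
    have "min (d j - ?t) 0 \<le> (d j - ?t) * (1 - w j)"
    proof (cases "d j \<ge> ?t")
      case True
      then show ?thesis using w1[of j] by simp
    next
      case False
      then have "(d j - ?t) * 1 \<le> (d j - ?t) * (1 - w j)"
        by (intro mult_left_mono_neg) (auto simp: w_def)
      then show ?thesis by (simp add: min.coboundedI1)
    qed
    then show "min (d j - ?t) 0 + ?t * (1 - w j) \<le> d j * (1 - w j)"
      by (simp add: algebra_simps)
  qed
  finally show ?thesis using eq by simp
qed

section \<open>POD matrices and neural networks\<close>

text \<open>The enumeration \<open>r\<close> reaches every number from 1 to \<open>CARD('h)\<close>,
  so \<open>V\<close> consists of the columns \<open>s i\<close> of the orthogonal matrix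
  \<open>W\<close>, and \<open>s\<close> is injective because \<open>e\<close> is.\<close>

lemma pod_matrix_orthonormal:
  fixes V :: "real^'n^'h" and U :: "real^'d^'h"
  assumes "pod_matrix U V" "CARD('n) \<le> CARD('h)"
  shows "transpose V ** V = mat 1"
proof -
  obtain r c W sg Z and e :: "'n \<Rightarrow> nat" where svd: "svd r c U W sg Z"
    and e: "bij_betw e UNIV {1..CARD('n)}"
    and V: "\<And>i j. e i = r j \<Longrightarrow> column i V = column j W"
    using assms(1) unfolding pod_matrix_def by blast
  have r: "bij_betw r UNIV {1..CARD('h)}" and W: "orthogonal_matrix W"
    using svd by (auto simp: svd_def)
  have "\<exists>j. e i = r j" for i
  proof -
    have "e i \<in> {1..CARD('h)}" using bij_betwE[OF e] assms(2) by fastforce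
    then show ?thesis using r by (metis UNIV_I bij_betw_iff_bijections)
  qed
  then obtain s where s: "\<And>i. e i = r (s i)" by metis
  have "s i \<noteq> s j" if "i \<noteq> j" for i j
    using that e s by (metis UNIV_I bij_betw_def inj_onD)
  then show ?thesis
    using W unfolding orthogonal_matrix_orthonormal_columns
    by (auto simp: V[OF s] matrix_mult_transpose_dot_column
        vec_eq_iff mat_def norm_eq_1 orthogonal_def)
qed

lemma continuous_on_hidden_layer:
  assumes "hidden_layer n f"
  shows "continuous_on UNIV (\<lambda>x. f x i)"
  using assms
proof (induction arbitrary: i)
  case (activation n f \<rho>)
  show ?case by (rule continuous_on_compose2[OF activation.hyps(2) activation.IH]) auto
qed (auto intro!: continuous_intros)

text \<open>Continuity makes the squared reconstruction error of a network integrable over the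
  compact parameter-time domain.\<close>

lemma continuous_on_neural_network:
  assumes "neural_network q"
  shows "continuous_on UNIV q"
  using assms by (auto simp: neural_network_def intro!: continuous_intros continuous_on_hidden_layer)

section \<open>Integration over the parameter-time domain\<close>

lemma space_param_time [simp]: "space (param_time P T) = P \<times> {0..T}"
  by (auto simp: param_time_def space_restrict_space)

lemma finite_measure_param_time:
  assumes "compact P"
  shows "finite_measure (param_time P T)"
proof
  have "compact (P \<times> {0..T})" using assms by (intro compact_Times) auto
  then have "emeasure lborel (P \<times> {0..T}) < \<infinity>" "P \<times> {0..T} \<in> sets lborel"
    using emeasure_compact_finite borel_compact by auto
  then show "emeasure (param_time P T) (space (param_time P T)) \<noteq> \<infinity>"
    unfolding space_param_time by (simp add: param_time_def emeasure_restrict_space)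
qed

text \<open>\<open>lborel\<close> and \<open>borel\<close> have the same measurable sets, hence so
  do their restrictions to the domain.\<close>

lemma borel_measurable_param_time:
  assumes "continuous_on (P \<times> {0..T}) f"
  shows "f \<in> borel_measurable (param_time P T)"
proof -
  have "borel_measurable (restrict_space lborel (P \<times> {0..T}))
      = borel_measurable (restrict_space borel (P \<times> {0..T}))"
    by (intro measurable_cong_sets sets_restrict_space_cong) auto
  then show ?thesis
    unfolding param_time_def using borel_measurable_continuous_on_restrict[OF assms] by blast
qed

lemma integrable_param_time:
  fixes f :: "_ \<Rightarrow> 'b::{banach,second_countable_topology}"
  assumes "compact P" "continuous_on (P \<times> {0..T}) f"
  shows "integrable (param_time P T) f"
proof -
  interpret finite_measure "param_time P T" using assms(1) by (rule finite_measure_param_time)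
  have "compact (f ` (P \<times> {0..T}))"
    using assms by (intro compact_continuous_image compact_Times) auto
  then obtain B where "\<And>x. x \<in> P \<times> {0..T} \<Longrightarrow> norm (f x) \<le> B"
    using compact_imp_bounded bounded_iff by (metis imageI)
  then show ?thesis
    by (intro integrable_const_bound[of _ B] borel_measurable_param_time assms AE_I2) auto
qed

section \<open>The correlation matrix\<close>

lemma transpose_correlation_matrix: "transpose (correlation_matrix P T u) = correlation_matrix P T u"
  by (simp add: correlation_matrix_def transpose_def vec_eq_iff mult.commute)

text \<open>Expanding the square gives a double sum whose integrals are the entries of the matrix.
  With the columns of \<open>V\<close> for \<open>v\<close>, this computes the energy captured by
  the POD space.\<close>

lemma quadratic_form_correlation_matrix:
  fixes u :: "(real^'p) \<times> real \<Rightarrow> real^'h"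
  assumes "compact P" "continuous_on (P \<times> {0..T}) u"
  shows "(\<integral>x. (v \<bullet> u x)\<^sup>2 \<partial>param_time P T) = v \<bullet> (correlation_matrix P T u *v v)"
proof -
  have [simp]: "integrable (param_time P T) (\<lambda>x. u x $ i * u x $ j)" for i j
    using assms by (intro integrable_param_time continuous_intros)
  have "(v \<bullet> u x)\<^sup>2 = (\<Sum>i\<in>UNIV. \<Sum>j\<in>UNIV. (v $ i * v $ j) * (u x $ i * u x $ j))" for x
    by (simp add: inner_vec_def power2_eq_square sum_product mult_ac)
  then have "(\<integral>x. (v \<bullet> u x)\<^sup>2 \<partial>param_time P T)
    = (\<Sum>i\<in>UNIV. \<Sum>j\<in>UNIV. (v $ i * v $ j) * (\<integral>x. u x $ i * u x $ j \<partial>param_time P T))"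
    by (simp add: Bochner_Integration.integral_sum)
  also have "\<dots> = v \<bullet> (correlation_matrix P T u *v v)"
    by (simp add: inner_vec_def matrix_vector_mult_def correlation_matrix_def sum_distrib_left mult_ac)
  finally show ?thesis .
qed

lemma trace_correlation_matrix:
  fixes u :: "(real^'p) \<times> real \<Rightarrow> real^'h"
  assumes "compact P" "continuous_on (P \<times> {0..T}) u"
  shows "(\<integral>x. (norm (u x))\<^sup>2 \<partial>param_time P T) = trace (correlation_matrix P T u)"
proof -
  have "integrable (param_time P T) (\<lambda>x. u x $ i * u x $ i)" for i
    using assms by (intro integrable_param_time continuous_intros)
  then show ?thesis
    unfolding power2_norm_eq_inner
    by (simp add: inner_vec_def trace_def correlation_matrix_def Bochner_Integration.integral_sum)
qed

section \<open>Error bounds\<close>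

lemma essinf_AE: "AE x in M. essinf M f \<le> f x"
proof -
  have "AE x in M. - f x \<le> esssup M (\<lambda>x. - f x)" by (rule esssup_AE)
  then show ?thesis
    by eventually_elim (simp add: essinf_def ereal_uminus_le_reorder)
qed

lemma projection_error_ge:
  fixes u :: "(real^'p) \<times> real \<Rightarrow> real^'h" and V :: "real^'n^'h"
  assumes "compact P" and u: "continuous_on (P \<times> {0..T}) u" and q: "continuous_on (P \<times> {0..T}) q"
    and V: "transpose V ** V = mat 1" and N: "CARD('n) \<le> CARD('h)"
    and lam: "ordered_eigenvalues (correlation_matrix P T u) lam"
  shows "(\<Sum>k\<in>{CARD('n)<..CARD('h)}. lam k)
    \<le> (\<integral>x. (norm (u x - V *v q x))\<^sup>2 \<partial>param_time P T)"
proof -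
  note [continuous_intros] = linear_continuous_on_compose[OF _ matrix_vector_mul_linear]
  have 1: "integrable (param_time P T) (\<lambda>x. (norm (u x))\<^sup>2)"
    and 2: "\<And>k. integrable (param_time P T) (\<lambda>x. (column k V \<bullet> u x)\<^sup>2)"
    and 3: "integrable (param_time P T) (\<lambda>x. (norm (u x - V *v q x))\<^sup>2)"
    using assms(1) u q by (auto intro!: integrable_param_time continuous_intros)
  have "(\<Sum>k\<in>{CARD('n)<..CARD('h)}. lam k)
    \<le> trace (correlation_matrix P T u)
      - (\<Sum>k\<in>UNIV. column k V \<bullet> (correlation_matrix P T u *v column k V))"
    by (intro trace_minus_compression_ge transpose_correlation_matrix V lam N)
  also have "\<dots> = (\<integral>x. (norm (u x))\<^sup>2 - (norm (transpose V *v u x))\<^sup>2 \<partial>param_time P T)"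
    unfolding norm_transpose_mult_power2 using 1 2 assms(1) u
    by (simp add: quadratic_form_correlation_matrix trace_correlation_matrix)
  \<comment> \<open>Discarding the square of \<open>norm (transpose V *v u x - q x)\<close> makes
    the bound uniform in \<open>q\<close>.\<close>
  also have "\<dots> \<le> (\<integral>x. (norm (u x - V *v q x))\<^sup>2 \<partial>param_time P T)"
  proof (rule integral_mono[OF _ 3])
    show "integrable (param_time P T) (\<lambda>x. (norm (u x))\<^sup>2 - (norm (transpose V *v u x))\<^sup>2)"
      unfolding norm_transpose_mult_power2 using 1 2 by simp
  qed (simp add: norm_diff_isometry_image[OF V])
  finally show ?thesis .
qed

text \<open>The bound \<open>M\<close> on the denominator gives the inequality between the
  integrands. The bound \<open>m\<close> serves integrability and excludes zero denominators, where
  division would return 0.\<close>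

lemma relative_error_ge:
  fixes u v :: "(real^'p) \<times> real \<Rightarrow> real^'h"
  assumes P: "compact P" and u: "continuous_on (P \<times> {0..T}) u" and v: "continuous_on (P \<times> {0..T}) v"
    and "m > 0" "M > 0"
    and m: "AE x in param_time P T. m \<le> norm (u x)"
    and M: "AE x in param_time P T. norm (u x) \<le> M"
  shows "sqrt (\<integral>x. (norm (u x - v x))\<^sup>2 \<partial>param_time P T) / M \<le> relative_error P T u v"
proof -
  have uv: "continuous_on (P \<times> {0..T}) (\<lambda>x. (norm (u x - v x))\<^sup>2)"
    using u v by (intro continuous_intros)
  have [measurable]: "(\<lambda>x. (norm (u x - v x))\<^sup>2) \<in> borel_measurable (param_time P T)"
      "u \<in> borel_measurable (param_time P T)"
    using u uv by (auto intro: borel_measurable_param_time)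
  have int_num: "integrable (param_time P T) (\<lambda>x. (norm (u x - v x))\<^sup>2)"
    using P uv by (rule integrable_param_time)
  \<comment> \<open>The integral of a non-integrable function is 0 by default, so monotonicity could
    fail without this.\<close>
  have int: "integrable (param_time P T) (\<lambda>x. (norm (u x - v x))\<^sup>2 / (norm (u x))\<^sup>2)"
  proof (rule Bochner_Integration.integrable_bound)
    show "integrable (param_time P T) (\<lambda>x. (norm (u x - v x))\<^sup>2 / m\<^sup>2)"
      using int_num by simp
    show "AE x in param_time P T. norm ((norm (u x - v x))\<^sup>2 / (norm (u x))\<^sup>2)
        \<le> norm ((norm (u x - v x))\<^sup>2 / m\<^sup>2)"
      using m
    proof eventually_elim
      case (elim x)
      then have "0 < norm (u x)" using \<open>m > 0\<close> by linarith
      then have "(norm (u x - v x))\<^sup>2 / (norm (u x))\<^sup>2 \<le> (norm (u x - v x))\<^sup>2 / m\<^sup>2"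
        using \<open>m > 0\<close> elim
        by (intro divide_left_mono power_mono mult_pos_pos zero_less_power) auto
      then show ?case by simp
    qed
  qed measurable
  have "(\<integral>x. (norm (u x - v x))\<^sup>2 \<partial>param_time P T) / M\<^sup>2
      = (\<integral>x. (norm (u x - v x))\<^sup>2 / M\<^sup>2 \<partial>param_time P T)"
    by simp
  also have "\<dots> \<le> (\<integral>x. (norm (u x - v x))\<^sup>2 / (norm (u x))\<^sup>2 \<partial>param_time P T)"
  proof (rule integral_mono_AE)
    show "AE x in param_time P T. (norm (u x - v x))\<^sup>2 / M\<^sup>2 \<le> (norm (u x - v x))\<^sup>2 / (norm (u x))\<^sup>2"
      using m M
    proof eventually_elim
      case (elim x)
      then have "0 < norm (u x)" using \<open>m > 0\<close> by linarith
      then show ?case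
        using elim \<open>M > 0\<close> by (intro divide_left_mono power_mono mult_pos_pos zero_less_power) auto
    qed
  qed (use int int_num in auto)
  finally have "sqrt ((\<integral>x. (norm (u x - v x))\<^sup>2 \<partial>param_time P T) / M\<^sup>2) \<le> relative_error P T u v"
    unfolding relative_error_def by (rule real_sqrt_le_mono)
  then show ?thesis using \<open>M > 0\<close> by (simp add: real_sqrt_divide)
qed

theorem theorem3p2:
  fixes P :: "(real^'p) set" and T L m M :: real
    and u :: "(real^'p) \<times> real \<Rightarrow> real^'h"
    and \<Omega> :: "'w measure" and \<mu> :: "nat \<Rightarrow> 'w \<Rightarrow> real^'p" and \<omega> :: 'w
    and Ns Nt :: nat
    and U :: "real^'d^'h" and col :: "'d \<Rightarrow> nat \<times> nat"
    and V :: "real^'n^'h"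
    and q :: "(real^'p) \<times> real \<Rightarrow> real^'n"
    and lam :: "nat \<Rightarrow> real"
  assumes N_le: "CARD('n) \<le> CARD('h)"
    and P: "compact P" "emeasure lborel P > 0" and T: "T > 0" and Nt: "Nt \<ge> 2"
    and Omega: "prob_space \<Omega>"
    and mu_in: "\<And>j w. j \<in> {1..Ns} \<Longrightarrow> w \<in> space \<Omega> \<Longrightarrow> \<mu> j w \<in> P"
    and mu_indep: "prob_space.indep_vars \<Omega> (\<lambda>_. borel) \<mu> {1..Ns}"
    and mu_unif: "\<And>j. j \<in> {1..Ns} \<Longrightarrow> distr \<Omega> borel (\<mu> j) = uniform_measure lborel P"
    and m: "ereal m = essinf (param_time P T) (\<lambda>x. ereal (norm (u x)))" "m > 0"
    and M: "ereal M = esssup (param_time P T) (\<lambda>x. ereal (norm (u x)))"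
    and Lip: "L > 0" "L-lipschitz_on (P \<times> {0..T}) u"
    and omega: "\<omega> \<in> space \<Omega>"
    and col: "bij_betw col UNIV ({1..Ns} \<times> {1..Nt})"
    and U: "\<And>d j k. col d = (j, k) \<Longrightarrow> column d U = u (\<mu> j \<omega>, real k * (T / real Nt))"
    and V: "pod_matrix U V"
    and q: "neural_network q"
    and lam: "ordered_eigenvalues (correlation_matrix P T u) lam"
  shows "relative_error P T u (\<lambda>x. V *v q x) \<ge> m / M * pod_error m CARD('n) CARD('h) lam"
proof -
  let ?M = "param_time P T" and ?S = "\<Sum>k\<in>{CARD('n)<..CARD('h)}. lam k"
  have u: "continuous_on (P \<times> {0..T}) u" using Lip(2) by (rule lipschitz_on_continuous_on)
  have qc: "continuous_on (P \<times> {0..T}) q"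
    using continuous_on_neural_network[OF q] continuous_on_subset by blast
  have Vq: "continuous_on (P \<times> {0..T}) (\<lambda>x. V *v q x)"
    using qc by (rule linear_continuous_on_compose[OF _ matrix_vector_mul_linear])
  have nu: "(\<lambda>x. ereal (norm (u x))) \<in> borel_measurable ?M"
    using borel_measurable_param_time[OF u] by simp
  have AEm: "AE x in ?M. m \<le> norm (u x)"
    using essinf_AE[of ?M "\<lambda>x. ereal (norm (u x))"] by (simp flip: m(1))
  have AEM: "AE x in ?M. norm (u x) \<le> M"
    using esssup_AE[of "\<lambda>x. ereal (norm (u x))" ?M] by (simp flip: M)
  \<comment> \<open>Over a null space \<open>esssup\<close> is minus infinity, which a real
    \<open>M\<close> rules out. Hence the constant \<open>m\<close> is its own essential supremum,
    and \<open>m \<le> M\<close> follows.\<close>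
  have "emeasure ?M (space ?M) \<noteq> 0"
    using esssup_zero_space[OF _ nu] M by auto
  then have "ereal m = esssup ?M (\<lambda>x. ereal m)" by (simp add: esssup_const)
  also have "\<dots> \<le> ereal M" unfolding M using AEm by (intro esssup_AE_mono) auto
  finally have "M > 0" using m(2) by simp
  \<comment> \<open>The factor \<open>m\<close> cancels against \<open>inverse m\<close> in
    \<open>pod_error\<close>.\<close>
  have "m / M * pod_error m CARD('n) CARD('h) lam = sqrt ?S / M"
    using m(2) by (simp add: pod_error_def field_simps)
  also have "\<dots> \<le> sqrt (\<integral>x. (norm (u x - V *v q x))\<^sup>2 \<partial>?M) / M"
    using \<open>M > 0\<close> projection_error_ge[OF P(1) u qc pod_matrix_orthonormal[OF V N_le] N_le lam]
    by (intro divide_right_mono real_sqrt_le_mono) auto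
  also have "\<dots> \<le> relative_error P T u (\<lambda>x. V *v q x)"
    by (rule relative_error_ge[OF P(1) u Vq m(2) \<open>M > 0\<close> AEm AEM])
  finally show ?thesis .
qed

end
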